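(* The infinite Tamari lattice satisfies $\mathrm{Tam}_\infty\simeq\varprojlim\mathrm{Tam}_n$ as posets, where the inverse limit (in the category of posets) is over positive integers $n$ with transition maps $\Psi_{nm}:\mathrm{Tam}_n\to\mathrm{Tam}_m$ for $m\le n$.
   Context: A pointed subset $(S,i)$ of a set $\mathcal{I}$ is a pair with $S\subseteq\mathcal{I}$, $i\in S$ (pointed at $i$), often identified with $S$. For a collection $\mathsf{B}$ of pointed subsets of $\mathcal{I}$, $\mathsf{B}|_i$ denotes those pointed at $i$; an ornamentation of $\mathsf{B}$ is a function $\rho:\mathcal{I}\to\mathsf{B}$ with $\rho(i)\in\mathsf{B}|_i$ for all $i$, and $\rho(j)\subseteq\rho(i)$ whenever $j\in\rho(i)$. $\mathcal{O}(\mathsf{B})$ is the set of ornamentations ordered by $\rho_1\preceq\rho_2$ iff $\rho_1(i)\subseteq\rho_2(i)$ for all $i$. For integers $a\le b$, $[a,b]:=\{i\in\mathbb{Z}\mid a\le i\le b\}$ and $[a,\infty):=\{i\in\mathbb{Z}\mid a\le i\}$. The Tamari lattice is $\mathrm{Tam}_n:=\mathcal{O}(\mathsf{B}_n)$ with $\mathcal{I}=\{1,\dots,n\}$ and $\mathsf{B}_n=\{([a,b],a)\mid 1\le a\le b\le n\}$. The infinite Tamari lattice is $\mathrm{Tam}_\infty:=\mathcal{O}(\mathsf{B})$ with $\mathcal{I}=\mathbb{Z}^+$ and $\mathsf{B}=\{([a,b],a)\mid a,b\in\mathbb{Z}^+,\ a\le b\}\cup\{([a,\infty),a)\mid a\in\mathbb{Z}^+\}$.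 For $m\le n$ the map $\Psi_{nm}:\mathrm{Tam}_n\to\mathrm{Tam}_m$ sends $\rho$ to the ornamentation whose value at $i\in\{1,\dots,m\}$ is the largest element of $\mathsf{B}_m|_i$ contained in $\rho(i)$. *)

theory Defs
  imports "HOL-Algebra.Order" "HOL-Library.FuncSet"
begin

section \<open>Posets: isomorphism and inverse limits\<close>

text \<open>
  \<^const>\<open>order_emb\<close> only compares the two orders, so together with bijectivity on the carriers
  it says that the map and its inverse are both monotone.
\<close>

definition poset_isomorphic :: "'a gorder \<Rightarrow> 'b gorder \<Rightarrow> bool"
  where "poset_isomorphic A B \<longleftrightarrow>
    partial_order A \<and> partial_order B \<and>
    (\<exists>f. bij_betw f (carrier A) (carrier B) \<and> order_emb A B f)"

text \<open>
  Compatible families, ordered componentwise. The transition map from stage \<open>n\<close> to stage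
  \<open>m \<le> n\<close> is \<open>\<phi> n m\<close>. The theorems \<open>inverse_limit_proj\<close> and \<open>inverse_limit_universal\<close> below show
  that this is the limit in the category of posets and monotone maps.
\<close>

definition inverse_limit ::
    "'i::order set \<Rightarrow> ('i \<Rightarrow> 'a gorder) \<Rightarrow> ('i \<Rightarrow> 'i \<Rightarrow> 'a \<Rightarrow> 'a) \<Rightarrow> ('i \<Rightarrow> 'a) gorder"
  where "inverse_limit J P \<phi> =
    \<lparr> carrier = {x \<in> \<Pi>\<^sub>E n\<in>J. carrier (P n). \<forall>m\<in>J. \<forall>n\<in>J. m \<le> n \<longrightarrow> \<phi> n m (x n) = x m},
      eq = (=),
      le = (\<lambda>x y. \<forall>n\<in>J. x n \<sqsubseteq>\<^bsub>P n\<^esub> y n) \<rparr>"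

definition inverse_system ::
    "'i::order set \<Rightarrow> ('i \<Rightarrow> 'a gorder) \<Rightarrow> ('i \<Rightarrow> 'i \<Rightarrow> 'a \<Rightarrow> 'a) \<Rightarrow> bool"
  where "inverse_system J P \<phi> \<longleftrightarrow>
    (\<forall>n\<in>J. partial_order (P n)) \<and>
    (\<forall>m\<in>J. \<forall>n\<in>J. m \<le> n \<longrightarrow>
       \<phi> n m \<in> carrier (P n) \<rightarrow> carrier (P m) \<and> isotone (P n) (P m) (\<phi> n m)) \<and>
    (\<forall>n\<in>J. \<forall>x\<in>carrier (P n). \<phi> n n x = x) \<and>
    (\<forall>k\<in>J. \<forall>m\<in>J. \<forall>n\<in>J. k \<le> m \<longrightarrow> m \<le> n \<longrightarrow>
       (\<forall>x\<in>carrier (P n). \<phi> m k (\<phi> n m x) = \<phi> n k x))"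


section \<open>Ornamentations\<close>

type_synonym 'a pointed = "'a set \<times> 'a"

definition pointed_subsets :: "'a set \<Rightarrow> 'a pointed set"
  where "pointed_subsets I = {(S, i). S \<subseteq> I \<and> i \<in> S}"

definition pointed_at :: "'a pointed set \<Rightarrow> 'a \<Rightarrow> 'a pointed set"
  where "pointed_at B i = {P \<in> B. snd P = i}"

text \<open>Ornamentations are \<open>undefined\<close> outside the ground set, so that each is a single HOL function.\<close>

definition ornamentations :: "'a set \<Rightarrow> 'a pointed set \<Rightarrow> ('a \<Rightarrow> 'a pointed) set"
  where "ornamentations I B =
    {\<rho> \<in> \<Pi>\<^sub>E i\<in>I. pointed_at B i. \<forall>i\<in>I. \<forall>j\<in>fst (\<rho> i). fst (\<rho> j) \<subseteq> fst (\<rho> i)}"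

definition ornamentation_poset :: "'a set \<Rightarrow> 'a pointed set \<Rightarrow> ('a \<Rightarrow> 'a pointed) gorder"
  where "ornamentation_poset I B =
    \<lparr> carrier = ornamentations I B,
      eq = (=),
      le = (\<lambda>\<rho>\<^sub>1 \<rho>\<^sub>2. \<forall>i\<in>I. fst (\<rho>\<^sub>1 i) \<subseteq> fst (\<rho>\<^sub>2 i)) \<rparr>"


section \<open>Tamari lattices\<close>

definition tam_pointed :: "int \<Rightarrow> int pointed set"
  where "tam_pointed n = {({a..b}, a) | a b. 1 \<le> a \<and> a \<le> b \<and> b \<le> n}"

definition Tam :: "int \<Rightarrow> (int \<Rightarrow> int pointed) gorder"
  where "Tam n = ornamentation_poset {1..n} (tam_pointed n)"

definition tam_inf_pointed :: "int pointed set"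
  where "tam_inf_pointed =
    {({a..b}, a) | a b. 1 \<le> a \<and> 1 \<le> b \<and> a \<le> b} \<union> {({a..}, a) | a. 1 \<le> a}"

definition Tam_inf :: "(int \<Rightarrow> int pointed) gorder"
  where "Tam_inf = ornamentation_poset {1..} tam_inf_pointed"

definition largest_pointed_in :: "'a pointed set \<Rightarrow> 'a set \<Rightarrow> 'a pointed"
  where "largest_pointed_in C S =
    (THE P. P \<in> C \<and> fst P \<subseteq> S \<and> (\<forall>Q\<in>C. fst Q \<subseteq> S \<longrightarrow> fst Q \<subseteq> fst P))"

definition Psi :: "int \<Rightarrow> int \<Rightarrow> (int \<Rightarrow> int pointed) \<Rightarrow> (int \<Rightarrow> int pointed)"
  where "Psi n m = (\<lambda>\<rho>\<in>carrier (Tam n). \<lambda>i\<in>{1..m}.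
    largest_pointed_in (pointed_at (tam_pointed m) i) (fst (\<rho> i)))"


section \<open>Basic properties\<close>

lemma partial_order_inverse_limit:
  assumes "\<And>n. n \<in> J \<Longrightarrow> partial_order (P n)"
  shows "partial_order (inverse_limit J P \<phi>)"
proof -
  have wpo: "weak_partial_order (P n)" if "n \<in> J" for n
    using assms[OF that] by (rule partial_order.axioms)
  have eqP: "eq (P n) = (=)" if "n \<in> J" for n
    using assms[OF that] by (rule partial_order.eq_is_equal)
  show ?thesis
  proof (unfold_locales, goal_cases)
    case (4 x)
    then show ?case
      using wpo by (force simp: inverse_limit_def PiE_iff intro: weak_partial_order.le_refl)
  next
    case (5 x y)
    then have "x n = y n" if "n \<in> J" for n
      using weak_partial_order.weak_le_antisym[OF wpo[OF that], of "x n" "y n"] eqP[OF that] that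
      by (auto simp: inverse_limit_def PiE_iff)
    with 5 show ?case
      by (auto simp: inverse_limit_def intro: PiE_ext)
  next
    case (6 x y z)
    then show ?case
      using wpo by (fastforce simp: inverse_limit_def PiE_iff intro: weak_partial_order.le_trans)
  qed (auto simp: inverse_limit_def)
qed

theorem inverse_limit_proj:
  assumes "inverse_system J P \<phi>" "n \<in> J"
  shows "(\<lambda>x. x n) \<in> carrier (inverse_limit J P \<phi>) \<rightarrow> carrier (P n)"
    and "isotone (inverse_limit J P \<phi>) (P n) (\<lambda>x. x n)"
proof -
  have po: "partial_order (P k)" if "k \<in> J" for k
    using assms(1) that by (auto simp: inverse_system_def)
  show "(\<lambda>x. x n) \<in> carrier (inverse_limit J P \<phi>) \<rightarrow> carrier (P n)"
    using assms(2) by (auto simp: inverse_limit_def)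
  show "isotone (inverse_limit J P \<phi>) (P n) (\<lambda>x. x n)"
    using partial_order.axioms(1)[OF po[OF assms(2)]]
      partial_order.axioms(1)[OF partial_order_inverse_limit[of J P \<phi>, OF po]] assms(2)
    by (auto simp: isotone_def) (auto simp: inverse_limit_def)
qed

theorem inverse_limit_universal:
  fixes Q :: "'q gorder"
  assumes sys: "inverse_system J P \<phi>"
    and Q: "partial_order Q"
    and f: "\<And>n. n \<in> J \<Longrightarrow> f n \<in> carrier Q \<rightarrow> carrier (P n)"
    and mono: "\<And>n. n \<in> J \<Longrightarrow> isotone Q (P n) (f n)"
    and compat: "\<And>m n q. m \<in> J \<Longrightarrow> n \<in> J \<Longrightarrow> m \<le> n \<Longrightarrow> q \<in> carrier Q \<Longrightarrow> \<phi> n m (f n q) = f m q"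
  shows "\<exists>!u. u \<in> carrier Q \<rightarrow>\<^sub>E carrier (inverse_limit J P \<phi>) \<and>
    isotone Q (inverse_limit J P \<phi>) u \<and> (\<forall>n\<in>J. \<forall>q\<in>carrier Q. u q n = f n q)"
proof (rule ex1I)
  let ?L = "inverse_limit J P \<phi>"
  let ?u = "\<lambda>q\<in>carrier Q. \<lambda>n\<in>J. f n q"
  have "partial_order ?L"
    by (rule partial_order_inverse_limit) (use sys in \<open>auto simp: inverse_system_def\<close>)
  then have "isotone Q ?L ?u"
    using partial_order.axioms(1)[OF Q] partial_order.axioms(1) mono
    by (auto simp: isotone_def) (auto simp: inverse_limit_def)
  moreover have "?u \<in> carrier Q \<rightarrow>\<^sub>E carrier ?L"
    using f compat by (auto simp: inverse_limit_def Pi_iff)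
  ultimately show "?u \<in> carrier Q \<rightarrow>\<^sub>E carrier ?L \<and> isotone Q ?L ?u \<and>
      (\<forall>n\<in>J. \<forall>q\<in>carrier Q. ?u q n = f n q)"
    by auto
  fix u
  assume u: "u \<in> carrier Q \<rightarrow>\<^sub>E carrier ?L \<and> isotone Q ?L u \<and> (\<forall>n\<in>J. \<forall>q\<in>carrier Q. u q n = f n q)"
  have "u q = ?u q" if "q \<in> carrier Q" for q
  proof (rule extensionalityI[of _ J])
    show "u q \<in> extensional J"
      using PiE_mem[of u "carrier Q" "\<lambda>_. carrier ?L" q] u that
      by (auto simp: inverse_limit_def PiE_iff)
  qed (use u that in auto)
  then show "u = ?u"
    using u by (intro extensionalityI[of _ "carrier Q"]) (auto simp: PiE_iff)
qed

lemma partial_order_ornamentation_poset: "partial_order (ornamentation_poset I B)"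
proof (unfold_locales, goal_cases)
  case (5 x y)
  have "x i = y i" if "i \<in> I" for i
  proof -
    have "x i \<in> pointed_at B i" "y i \<in> pointed_at B i" "fst (x i) = fst (y i)"
      using 5 that by (auto simp: ornamentation_poset_def ornamentations_def PiE_iff)
    then show ?thesis by (auto simp: pointed_at_def prod_eq_iff)
  qed
  with 5 show ?case
    by (auto simp: ornamentation_poset_def ornamentations_def intro: PiE_ext)
qed (auto simp: ornamentation_poset_def; blast)+

lemma tam_pointed_subset: "tam_pointed n \<subseteq> pointed_subsets {1..n}"
  by (auto simp: tam_pointed_def pointed_subsets_def)

lemma tam_inf_pointed_subset: "tam_inf_pointed \<subseteq> pointed_subsets {1..}"
  by (auto simp: tam_inf_pointed_def pointed_subsets_def)

lemma Tam_value:
  assumes "\<rho> \<in> carrier (Tam n)" "i \<in> {1..n}"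
  obtains b where "\<rho> i = ({i..b}, i)" "i \<le> b" "b \<le> n"
proof -
  have "\<rho> i \<in> pointed_at (tam_pointed n) i"
    using assms by (auto simp: Tam_def ornamentation_poset_def ornamentations_def)
  then show ?thesis
    using that by (auto simp: pointed_at_def tam_pointed_def)
qed

lemma largest_pointed_in_tam:
  assumes "i \<in> {1..m}" "i \<le> b"
  shows "largest_pointed_in (pointed_at (tam_pointed m) i) {i..b} = ({i..min b m}, i)"
  unfolding largest_pointed_in_def
proof (rule the_equality)
  let ?M = "({i..min b m}, i)"
  have M: "?M \<in> pointed_at (tam_pointed m) i"
    using assms by (auto simp: pointed_at_def tam_pointed_def)
  moreover have max: "fst Q \<subseteq> {i..min b m}"
    if "Q \<in> pointed_at (tam_pointed m) i" "fst Q \<subseteq> {i..b}" for Q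
    using that by (auto simp: pointed_at_def tam_pointed_def)
  ultimately show "?M \<in> pointed_at (tam_pointed m) i \<and> fst ?M \<subseteq> {i..b} \<and>
      (\<forall>Q\<in>pointed_at (tam_pointed m) i. fst Q \<subseteq> {i..b} \<longrightarrow> fst Q \<subseteq> fst ?M)"
    by auto
  fix P
  assume P: "P \<in> pointed_at (tam_pointed m) i \<and> fst P \<subseteq> {i..b} \<and>
      (\<forall>Q\<in>pointed_at (tam_pointed m) i. fst Q \<subseteq> {i..b} \<longrightarrow> fst Q \<subseteq> fst P)"
  have "fst ?M \<subseteq> {i..b}"
    by auto
  then have "fst ?M \<subseteq> fst P"
    using P M by blast
  moreover have "fst P \<subseteq> fst ?M" "snd P = i"
    using P max[of P] by (auto simp: pointed_at_def)
  ultimately show "P = ?M"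
    by (auto simp: prod_eq_iff)
qed

lemma Psi_apply:
  assumes "\<rho> \<in> carrier (Tam n)" "m \<le> n" "i \<in> {1..m}"
  shows "Psi n m \<rho> i = (fst (\<rho> i) \<inter> {1..m}, i)"
proof -
  obtain b where b: "\<rho> i = ({i..b}, i)" "i \<le> b" "b \<le> n"
    using Tam_value[OF assms(1), of i] assms by auto
  then have "Psi n m \<rho> i = ({i..min b m}, i)"
    using assms largest_pointed_in_tam[of i m b] by (simp add: Psi_def)
  also have "{i..min b m} = {i..b} \<inter> {1..m}"
    using assms by auto
  finally show ?thesis
    using b by simp
qed

lemma Psi_closed:
  assumes "\<rho> \<in> carrier (Tam n)" "m \<le> n"
  shows "Psi n m \<rho> \<in> carrier (Tam m)"
proof -
  have "Psi n m \<rho> i \<in> pointed_at (tam_pointed m) i" if i: "i \<in> {1..m}" for i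
  proof -
    obtain b where b: "\<rho> i = ({i..b}, i)" "i \<le> b" "b \<le> n"
      using Tam_value[OF assms(1), of i] i assms by auto
    have "Psi n m \<rho> i = ({i..min b m}, i)"
      using b i assms largest_pointed_in_tam[of i m b] by (simp add: Psi_def)
    then show ?thesis
      using b i by (auto simp: pointed_at_def tam_pointed_def)
  qed
  moreover have "Psi n m \<rho> \<in> extensional {1..m}"
    using assms by (simp add: Psi_def)
  moreover have "fst (Psi n m \<rho> j) \<subseteq> fst (Psi n m \<rho> i)"
    if "i \<in> {1..m}" "j \<in> fst (Psi n m \<rho> i)" for i j
  proof -
    have j: "j \<in> fst (\<rho> i)" "j \<in> {1..m}"
      using that Psi_apply[OF assms, of i] by auto
    moreover have "i \<in> {1..n}"
      using that assms by auto
    ultimately have "fst (\<rho> j) \<subseteq> fst (\<rho> i)"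
      using assms(1) by (auto simp: Tam_def ornamentation_poset_def ornamentations_def)
    then show ?thesis
      using that j Psi_apply[OF assms] by auto
  qed
  ultimately show ?thesis
    by (auto simp: Tam_def ornamentation_poset_def ornamentations_def PiE_iff)
qed

lemma Tam_ext:
  assumes "\<rho> \<in> carrier (Tam n)" "\<sigma> \<in> carrier (Tam n)"
    and "\<And>i. i \<in> {1..n} \<Longrightarrow> fst (\<rho> i) = fst (\<sigma> i)"
  shows "\<rho> = \<sigma>"
proof (rule extensionalityI[of _ "{1..n}"])
  fix i assume "i \<in> {1..n}"
  then show "\<rho> i = \<sigma> i"
    using Tam_value[OF assms(1)] Tam_value[OF assms(2)] assms(3) by (metis fst_conv)
qed (use assms in \<open>auto simp: Tam_def ornamentation_poset_def ornamentations_def PiE_iff\<close>)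

theorem inverse_system_Tam: "inverse_system {1..} Tam Psi"
proof -
  have po: "partial_order (Tam n)" for n
    by (simp add: Tam_def partial_order_ornamentation_poset)
  have "isotone (Tam n) (Tam m) (Psi n m)" if "m \<le> n" for m n
  proof -
    have "Psi n m \<rho> \<sqsubseteq>\<^bsub>Tam m\<^esub> Psi n m \<sigma>"
      if h: "\<rho> \<in> carrier (Tam n)" "\<sigma> \<in> carrier (Tam n)" "\<rho> \<sqsubseteq>\<^bsub>Tam n\<^esub> \<sigma>" for \<rho> \<sigma>
    proof -
      have "fst (\<rho> i) \<subseteq> fst (\<sigma> i)" if "i \<in> {1..m}" for i
        using h(3) that \<open>m \<le> n\<close> by (simp add: Tam_def ornamentation_poset_def)
      then show ?thesis
        using Psi_apply[OF h(1) \<open>m \<le> n\<close>] Psi_apply[OF h(2) \<open>m \<le> n\<close>]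
        unfolding Tam_def by (fastforce simp: ornamentation_poset_def)
    qed
    then show ?thesis
      using partial_order.axioms(1)[OF po] by (auto simp: isotone_def)
  qed
  moreover have "Psi n n \<rho> = \<rho>" if \<rho>: "\<rho> \<in> carrier (Tam n)" for n \<rho>
  proof (rule Tam_ext[OF Psi_closed[OF \<rho> order_refl] \<rho>])
    fix i assume i: "i \<in> {1..n}"
    obtain b where b: "\<rho> i = ({i..b}, i)" "i \<le> b" "b \<le> n"
      using Tam_value[OF \<rho> i] .
    show "fst (Psi n n \<rho> i) = fst (\<rho> i)"
      using Psi_apply[OF \<rho> order_refl i] b i by auto
  qed
  moreover have "Psi m k (Psi n m \<rho>) = Psi n k \<rho>"
    if "k \<le> m" "m \<le> n" and \<rho>: "\<rho> \<in> carrier (Tam n)" for k m n \<rho>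
  proof (rule Tam_ext)
    have kn: "k \<le> n" and \<rho>': "Psi n m \<rho> \<in> carrier (Tam m)"
      using that Psi_closed by auto
    show "Psi m k (Psi n m \<rho>) \<in> carrier (Tam k)" "Psi n k \<rho> \<in> carrier (Tam k)"
      using Psi_closed[OF \<rho>' \<open>k \<le> m\<close>] Psi_closed[OF \<rho> kn] .
    fix i assume i: "i \<in> {1..k}"
    then have "i \<in> {1..m}"
      using that by auto
    then show "fst (Psi m k (Psi n m \<rho>) i) = fst (Psi n k \<rho> i)"
      using Psi_apply[OF \<rho>' \<open>k \<le> m\<close> i] Psi_apply[OF \<rho> kn i] Psi_apply[OF \<rho> \<open>m \<le> n\<close>, of i] that
      by auto
  qed
  ultimately show ?thesis
    using po Psi_closed by (simp add: inverse_system_def)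
qed

end

theory Submission
  imports Defs
begin

text \<open>
  The isomorphism truncates: an ornamentation \<open>\<rho>\<close> of the positive integers is sent to the family
  whose \<open>n\<close>-th member is \<open>i \<mapsto> \<rho>(i) \<inter> [1,n]\<close>, and a compatible family \<open>x\<close> is sent back to
  \<open>i \<mapsto> \<Union>\<^sub>n x\<^sub>n(i)\<close>, the union being over \<open>n \<ge> i\<close>. A set of positive integers is the union of its truncations, so inclusion can be
  tested on truncations; hence the first map preserves and reflects the order, and is injective.

  The remaining point is that the union of a compatible family is again an admissible value. An
  increasing union of intervals \<open>[i,b]\<close> is either such an interval or the whole ray \<open>[i,\<infty>)\<close>, which
  is exactly why the rays are adjoined in the infinite Tamari lattice. Both cases are treated at
  once by describing the admissible sets intrinsically, as the nonempty initial segments of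
  \<open>[i,\<infty>)\<close> (lemmas \<open>carrier_Tam_iff\<close> and \<open>carrier_Tam_inf_iff\<close>): this description is visibly
  stable under truncation and under unions.
\<close>

section \<open>Initial segments of integer rays\<close>

definition initial_segment :: "int \<Rightarrow> int set \<Rightarrow> bool"
  where "initial_segment i S \<longleftrightarrow> i \<in> S \<and> S \<subseteq> {i..} \<and> (\<forall>s\<in>S. {i..s} \<subseteq> S)"

text \<open>A bounded initial segment ends at its maximum; an unbounded one reaches past every integer.\<close>

lemma initial_segment_cases:
  assumes "initial_segment i S"
  obtains "S = {i..}" | b where "i \<le> b" "S = {i..b}"
proof (cases "bdd_above S")
  case True
  have S: "i \<in> S" "S \<subseteq> {i..}" "\<And>s. s \<in> S \<Longrightarrow> {i..s} \<subseteq> S"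
    using assms by (auto simp: initial_segment_def)
  obtain c where "S \<subseteq> {i..c}"
    using True S(2) by (force simp: bdd_above_def)
  then have fin: "finite S"
    by (rule finite_subset) simp
  have "Max S \<in> S"
    using fin S(1) by (intro Max_in) auto
  then have "S = {i..Max S}"
    using S Max_ge[OF fin] by force
  with that(2) S(1) \<open>Max S \<in> S\<close> show ?thesis
    by (metis S(2) atLeast_iff subsetD)
next
  case False
  have "t \<in> S" if "i \<le> t" for t
  proof -
    obtain s where "s \<in> S" "t < s"
      using False by (force simp: bdd_above_def not_le)
    with assms that show ?thesis
      by (force simp: initial_segment_def)
  qed
  with assms that(1) show ?thesis
    by (force simp: initial_segment_def)
qed

lemma initial_segment_interval: "i \<le> b \<Longrightarrow> initial_segment i {i..b}"
  by (auto simp: initial_segment_def)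

lemma initial_segment_ray: "initial_segment i {i..}"
  by (auto simp: initial_segment_def)

lemma initial_segment_truncate:
  "initial_segment i S \<Longrightarrow> 1 \<le> i \<Longrightarrow> i \<le> n \<Longrightarrow> initial_segment i (S \<inter> {1..n})"
  by (force simp: initial_segment_def)

lemma initial_segment_UN:
  "K \<noteq> {} \<Longrightarrow> (\<And>k. k \<in> K \<Longrightarrow> initial_segment i (S k)) \<Longrightarrow> initial_segment i (\<Union>k\<in>K. S k)"
  by (fastforce simp: initial_segment_def)

section \<open>Tamari lattices in terms of initial segments\<close>

lemma pointed_at_tam_iff:
  assumes "1 \<le> i"
  shows "P \<in> pointed_at (tam_pointed n) i \<longleftrightarrow>
    snd P = i \<and> initial_segment i (fst P) \<and> fst P \<subseteq> {1..n}"
proof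
  assume "P \<in> pointed_at (tam_pointed n) i"
  then show "snd P = i \<and> initial_segment i (fst P) \<and> fst P \<subseteq> {1..n}"
    using assms by (auto simp: pointed_at_def tam_pointed_def intro: initial_segment_interval)
next
  assume P: "snd P = i \<and> initial_segment i (fst P) \<and> fst P \<subseteq> {1..n}"
  then have "initial_segment i (fst P)"
    by blast
  then show "P \<in> pointed_at (tam_pointed n) i"
  proof (cases rule: initial_segment_cases)
    case 1
    then have "max i (n + 1) \<in> fst P"
      by simp
    with P have False
      by force
    then show ?thesis ..
  next
    case (2 b)
    with P have "b \<le> n"
      by auto
    with 2 P assms show ?thesis
      by (auto simp: pointed_at_def tam_pointed_def prod_eq_iff)
  qed
qed

lemma pointed_at_tam_inf_iff:
  assumes "1 \<le> i"
  shows "P \<in> pointed_at tam_inf_pointed i \<longleftrightarrow> snd P = i \<and> initial_segment i (fst P)"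
proof
  assume "P \<in> pointed_at tam_inf_pointed i"
  then show "snd P = i \<and> initial_segment i (fst P)"
    by (auto simp: pointed_at_def tam_inf_pointed_def
        intro: initial_segment_interval initial_segment_ray)
next
  assume P: "snd P = i \<and> initial_segment i (fst P)"
  then have "initial_segment i (fst P)"
    by blast
  then show "P \<in> pointed_at tam_inf_pointed i"
    by (cases rule: initial_segment_cases)
      (use P assms in \<open>auto simp: pointed_at_def tam_inf_pointed_def prod_eq_iff\<close>)
qed

lemma carrier_Tam_iff:
  "\<rho> \<in> carrier (Tam n) \<longleftrightarrow>
    \<rho> \<in> extensional {1..n} \<and>
    (\<forall>i\<in>{1..n}. snd (\<rho> i) = i \<and> initial_segment i (fst (\<rho> i)) \<and> fst (\<rho> i) \<subseteq> {1..n}) \<and>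
    (\<forall>i\<in>{1..n}. \<forall>j\<in>fst (\<rho> i). fst (\<rho> j) \<subseteq> fst (\<rho> i))"
  by (auto simp: Tam_def ornamentation_poset_def ornamentations_def PiE_iff pointed_at_tam_iff)

lemma carrier_Tam_inf_iff:
  "\<rho> \<in> carrier Tam_inf \<longleftrightarrow>
    \<rho> \<in> extensional {1..} \<and>
    (\<forall>i\<in>{1..}. snd (\<rho> i) = i \<and> initial_segment i (fst (\<rho> i))) \<and>
    (\<forall>i\<in>{1..}. \<forall>j\<in>fst (\<rho> i). fst (\<rho> j) \<subseteq> fst (\<rho> i))"
  by (auto simp: Tam_inf_def ornamentation_poset_def ornamentations_def PiE_iff
      pointed_at_tam_inf_iff)

lemma le_Tam_iff: "\<rho> \<sqsubseteq>\<^bsub>Tam n\<^esub> \<sigma> \<longleftrightarrow> (\<forall>i\<in>{1..n}. fst (\<rho> i) \<subseteq> fst (\<sigma> i))"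
  by (simp add: Tam_def ornamentation_poset_def)

lemma le_Tam_inf_iff: "\<rho> \<sqsubseteq>\<^bsub>Tam_inf\<^esub> \<sigma> \<longleftrightarrow> (\<forall>i\<in>{1..}. fst (\<rho> i) \<subseteq> fst (\<sigma> i))"
  by (simp add: Tam_inf_def ornamentation_poset_def)

section \<open>Truncation\<close>

definition truncate :: "int \<Rightarrow> (int \<Rightarrow> int pointed) \<Rightarrow> int \<Rightarrow> int pointed"
  where "truncate n \<rho> = (\<lambda>i\<in>{1..n}. (fst (\<rho> i) \<inter> {1..n}, i))"

definition truncations :: "(int \<Rightarrow> int pointed) \<Rightarrow> int \<Rightarrow> int \<Rightarrow> int pointed"
  where "truncations \<rho> = (\<lambda>n\<in>{1..}. truncate n \<rho>)"

lemma truncate_closed: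
  assumes "\<rho> \<in> carrier Tam_inf"
  shows "truncate n \<rho> \<in> carrier (Tam n)"
  unfolding carrier_Tam_iff
proof (intro conjI ballI)
  fix i assume i: "i \<in> {1..n}"
  then have "initial_segment i (fst (\<rho> i))"
    using assms by (simp add: carrier_Tam_inf_iff)
  then show "initial_segment i (fst (truncate n \<rho> i))"
    using i by (auto simp: truncate_def intro: initial_segment_truncate)
  fix j assume j: "j \<in> fst (truncate n \<rho> i)"
  then have "fst (\<rho> j) \<subseteq> fst (\<rho> i)"
    using assms i by (auto simp: carrier_Tam_inf_iff truncate_def)
  then show "fst (truncate n \<rho> j) \<subseteq> fst (truncate n \<rho> i)"
    using i j by (auto simp: truncate_def)
qed (auto simp: truncate_def)

lemma Psi_truncate:
  assumes "\<rho> \<in> carrier Tam_inf" "m \<le> n"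
  shows "Psi n m (truncate n \<rho>) = truncate m \<rho>"
proof (rule Tam_ext)
  have cl: "truncate n \<rho> \<in> carrier (Tam n)"
    using assms(1) by (rule truncate_closed)
  show "Psi n m (truncate n \<rho>) \<in> carrier (Tam m)"
    using cl assms(2) by (rule Psi_closed)
  show "truncate m \<rho> \<in> carrier (Tam m)"
    using assms(1) by (rule truncate_closed)
  fix i assume "i \<in> {1..m}"
  then show "fst (Psi n m (truncate n \<rho>) i) = fst (truncate m \<rho> i)"
    using Psi_apply[OF cl assms(2)] assms(2) by (auto simp: truncate_def)
qed

lemma truncations_closed:
  "\<rho> \<in> carrier Tam_inf \<Longrightarrow> truncations \<rho> \<in> carrier (inverse_limit {1..} Tam Psi)"
  by (auto simp: inverse_limit_def truncations_def truncate_closed Psi_truncate)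

text \<open>
  Only finite stages are compared on the left, and they suffice: an element \<open>t \<ge> i\<close> of \<open>\<rho>(i)\<close> is already visible in
  the truncation at \<open>t\<close>.
\<close>

lemma truncations_le_iff:
  assumes \<rho>: "\<rho> \<in> carrier Tam_inf"
  shows "truncations \<rho> \<sqsubseteq>\<^bsub>inverse_limit {1..} Tam Psi\<^esub> truncations \<sigma> \<longleftrightarrow> \<rho> \<sqsubseteq>\<^bsub>Tam_inf\<^esub> \<sigma>"
proof -
  have "truncations \<rho> \<sqsubseteq>\<^bsub>inverse_limit {1..} Tam Psi\<^esub> truncations \<sigma> \<longleftrightarrow>
      (\<forall>n\<ge>1. \<forall>i\<in>{1..n}. fst (\<rho> i) \<inter> {1..n} \<subseteq> fst (\<sigma> i))"
    by (auto simp: inverse_limit_def truncations_def truncate_def le_Tam_iff)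
  also have "\<dots> \<longleftrightarrow> (\<forall>i\<in>{1..}. fst (\<rho> i) \<subseteq> fst (\<sigma> i))"
  proof (intro iffI ballI subsetI)
    fix i t assume *: "\<forall>n\<ge>1. \<forall>i\<in>{1..n}. fst (\<rho> i) \<inter> {1..n} \<subseteq> fst (\<sigma> i)"
      and i: "i \<in> {1..}" and t: "t \<in> fst (\<rho> i)"
    have "i \<le> t"
      using \<rho> i t by (auto simp: carrier_Tam_inf_iff initial_segment_def)
    with i t *[rule_format, of t i] show "t \<in> fst (\<sigma> i)"
      by auto
  qed auto
  finally show ?thesis
    by (simp add: le_Tam_inf_iff)
qed

section \<open>Gluing compatible families\<close>

text \<open>The stages \<open>n < i\<close> are left out because \<open>x n i\<close> is \<open>undefined\<close> there.\<close>

definition glue :: "(int \<Rightarrow> int \<Rightarrow> int pointed) \<Rightarrow> int \<Rightarrow> int pointed"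
  where "glue x = (\<lambda>i\<in>{1..}. (\<Union>n\<in>{i..}. fst (x n i), i))"

lemma inverse_limit_Tam_coherent:
  assumes "x \<in> carrier (inverse_limit {1..} Tam Psi)" "m \<le> n" "i \<in> {1..m}"
  shows "fst (x m i) = fst (x n i) \<inter> {1..m}"
proof -
  have "x n \<in> carrier (Tam n)" "Psi n m (x n) = x m"
    using assms by (auto simp: inverse_limit_def)
  then show ?thesis
    using Psi_apply[of "x n" n m i] assms by simp
qed

text \<open>Later stages add to the value at \<open>i\<close> only elements beyond \<open>n\<close>, by coherence.\<close>

lemma glue_inter:
  assumes x: "x \<in> carrier (inverse_limit {1..} Tam Psi)" and i: "i \<in> {1..n}"
  shows "fst (glue x i) \<inter> {1..n} = fst (x n i)"
proof
  have "x n \<in> carrier (Tam n)"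
    using x i by (auto simp: inverse_limit_def)
  with i show "fst (x n i) \<subseteq> fst (glue x i) \<inter> {1..n}"
    by (auto simp: glue_def carrier_Tam_iff)
  show "fst (glue x i) \<inter> {1..n} \<subseteq> fst (x n i)"
  proof
    fix t assume "t \<in> fst (glue x i) \<inter> {1..n}"
    then obtain k where k: "i \<le> k" "t \<in> fst (x k i)" "t \<in> {1..n}"
      using i by (auto simp: glue_def)
    show "t \<in> fst (x n i)"
    proof (cases "k \<le> n")
      case True
      then show ?thesis
        using inverse_limit_Tam_coherent[OF x, of k n i] k i by auto
    next
      case False
      then show ?thesis
        using inverse_limit_Tam_coherent[OF x, of n k i] k i by auto
    qed
  qed
qed

lemma glue_closed:
  assumes x: "x \<in> carrier (inverse_limit {1..} Tam Psi)"
  shows "glue x \<in> carrier Tam_inf"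
  unfolding carrier_Tam_inf_iff
proof (intro conjI ballI)
  have xn: "x n \<in> carrier (Tam n)" if "1 \<le> n" for n
    using x that by (auto simp: inverse_limit_def)
  have seg: "initial_segment i (fst (glue x i))" if i: "1 \<le> i" for i
  proof -
    have "initial_segment i (\<Union>n\<in>{i..}. fst (x n i))"
      by (rule initial_segment_UN) (use i xn in \<open>auto simp: carrier_Tam_iff\<close>)
    with i show ?thesis
      by (simp add: glue_def)
  qed
  have lower: "i \<le> j" if "1 \<le> i" "j \<in> fst (glue x i)" for i j
    using seg[OF that(1)] that(2) unfolding initial_segment_def by blast
  fix i :: int assume i: "i \<in> {1..}"
  then show "initial_segment i (fst (glue x i))"
    using seg by simp
  fix j assume j: "j \<in> fst (glue x i)"
  have ij: "i \<le> j"
    using lower i j by simp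
  show "fst (glue x j) \<subseteq> fst (glue x i)"
  proof
    fix t assume t: "t \<in> fst (glue x j)"
    have jt: "j \<le> t"
      using lower[of j t] i ij t by simp
    \<comment> \<open>Stage \<open>t\<close> already sees both \<open>j\<close> and \<open>t\<close>, and \<open>x t\<close> is an ornamentation.\<close>
    have i': "i \<in> {1..t}" and j': "j \<in> {1..t}"
      using i ij jt by auto
    have "j \<in> fst (x t i)" "t \<in> fst (x t j)"
      using glue_inter[OF x i'] glue_inter[OF x j'] j t j' by auto
    moreover have "x t \<in> carrier (Tam t)"
      using xn i' by simp
    ultimately have "t \<in> fst (x t i)"
      using i' unfolding carrier_Tam_iff by blast
    then show "t \<in> fst (glue x i)"
      using glue_inter[OF x i'] by blast
  qed
qed (auto simp: glue_def)

lemma truncations_glue: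
  assumes x: "x \<in> carrier (inverse_limit {1..} Tam Psi)"
  shows "truncations (glue x) = x"
proof (rule extensionalityI[of _ "{1..}"])
  show "truncations (glue x) \<in> extensional {1..}"
    by (simp add: truncations_def)
  show "x \<in> extensional {1..}"
    using x by (auto simp: inverse_limit_def PiE_iff)
  fix n :: int assume n: "n \<in> {1..}"
  have "truncate n (glue x) = x n"
  proof (rule Tam_ext)
    show "truncate n (glue x) \<in> carrier (Tam n)"
      using glue_closed[OF x] by (rule truncate_closed)
    show "x n \<in> carrier (Tam n)"
      using x n by (auto simp: inverse_limit_def)
  qed (use glue_inter[OF x] in \<open>simp add: truncate_def\<close>)
  with n show "truncations (glue x) n = x n"
    by (simp add: truncations_def)
qed

section \<open>The infinite Tamari lattice as an inverse limit\<close>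

theorem corollary7p9:
  shows "poset_isomorphic Tam_inf (inverse_limit {1..} Tam Psi)"
proof -
  let ?L = "inverse_limit {1..} Tam Psi"
  have po: "partial_order Tam_inf"
    by (simp add: Tam_inf_def partial_order_ornamentation_poset)
  have poL: "partial_order ?L"
    by (rule partial_order_inverse_limit) (simp add: Tam_def partial_order_ornamentation_poset)
  have "inj_on truncations (carrier Tam_inf)"
  proof (rule inj_onI)
    fix \<rho> \<sigma> assume *: "\<rho> \<in> carrier Tam_inf" "\<sigma> \<in> carrier Tam_inf" "truncations \<rho> = truncations \<sigma>"
    have refl: "truncations \<rho> \<sqsubseteq>\<^bsub>?L\<^esub> truncations \<rho>"
      using truncations_le_iff[OF *(1), of \<rho>] by (simp add: le_Tam_inf_iff)
    have "\<rho> \<sqsubseteq>\<^bsub>Tam_inf\<^esub> \<sigma>" "\<sigma> \<sqsubseteq>\<^bsub>Tam_inf\<^esub> \<rho>"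
      using refl truncations_le_iff[of \<rho> \<sigma>] truncations_le_iff[of \<sigma> \<rho>] * by simp_all
    then show "\<rho> = \<sigma>"
      using partial_order.le_antisym[OF po] * by blast
  qed
  moreover have "truncations ` carrier Tam_inf = carrier ?L"
    using truncations_closed glue_closed truncations_glue
    by (metis image_eqI image_subsetI subsetI subset_antisym)
  ultimately have "bij_betw truncations (carrier Tam_inf) (carrier ?L)"
    by (simp add: bij_betw_def)
  moreover have "order_emb Tam_inf ?L truncations"
    using truncations_le_iff partial_order.axioms(1)[OF po] partial_order.axioms(1)[OF poL]
    by (simp add: order_emb_def)
  ultimately show ?thesis
    using po poL by (auto simp: poset_isomorphic_def)
qed

end
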